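(* Let $m\in\mathbb{N}\setminus\{1,2\}$, $k\in\mathbb{N}$, and let $\ell_2^m$ and $\ell_2$ be the complex Hilbert spaces. Then (i) $n_{(2,k)}(\ell_2^m)=\frac{1}{2\sqrt{k}}$, where $1\leq k<m$. (ii) $n_{(2,k)}(\ell_2)=\frac{1}{2\sqrt{k}}$. (iii) $n_{(p,2)}(\ell_2^m)=\frac{1}{2^{1+\frac{1}{p}}}$, where $2<p<\infty$. (iv) $n_{(p,2)}(\ell_2)=\frac{1}{2^{1+\frac{1}{p}}}$, where $2<p<\infty$.
   Context: $\ell_2^m$ denotes $\mathbb{C}^m$ with the Euclidean norm. For a Banach space $X$, $L(X)$ is the space of bounded linear operators on $X$, $S_X$ its unit sphere, $X^*$ its dual, and $\Pi_X=\{(x,x^* )\in S_X\times S_{X^*}: x^*(x)=1\}$. For $1\leq p<\infty$, $k\in\mathbb{N}$ and $\mathcal{T}=(T_1,\ldots,T_k)\in L(X)^k$, put $\|\mathcal{T}\|_p=\sup\{(\sum_{i=1}^k\|T_ix\|^p)^{1/p}:x\in S_X\}$ and $w_p(\mathcal{T})=\sup\{(\sum_{i=1}^k|x^*(T_ix)|^p)^{1/p}:(x,x^* )\in\Pi_X\}$. The $(p,k)$-th joint numerical index of $X$ is $n_{(p,k)}(X)=\inf\{w_p(\mathcal{T}):\mathcal{T}\in L(X)^k,\ \|\mathcal{T}\|_p=1\}$. *)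

theory Defs
  imports "HOL-Analysis.Analysis"
begin

section \<open>Complex Banach spaces\<close>

class scaleC =
  fixes scaleC :: "complex \<Rightarrow> 'a \<Rightarrow> 'a" (infixr "*\<^sub>C" 75)

text \<open>The real structure is the one obtained from the complex one by restriction of scalars.\<close>

class complex_normed_vector = real_normed_vector + scaleC +
  assumes scaleC_add_right: "a *\<^sub>C (x + y) = a *\<^sub>C x + a *\<^sub>C y"
    and scaleC_add_left: "(a + b) *\<^sub>C x = a *\<^sub>C x + b *\<^sub>C x"
    and scaleC_scaleC: "a *\<^sub>C (b *\<^sub>C x) = (a * b) *\<^sub>C x"
    and scaleC_one: "1 *\<^sub>C x = x"
    and scaleC_of_real: "complex_of_real r *\<^sub>C x = r *\<^sub>R x"
    and norm_scaleC: "norm (a *\<^sub>C x) = cmod a * norm x"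

class complex_banach = complex_normed_vector + complete_space

instantiation complex :: complex_banach
begin

definition scaleC_complex :: "complex \<Rightarrow> complex \<Rightarrow> complex" where
  "a *\<^sub>C x = a * x"

instance
  by standard (simp_all add: scaleC_complex_def algebra_simps norm_mult scaleR_conv_of_real)

end

text \<open>The norm of \<open>complex ^ 'm\<close> is the Euclidean one, so \<open>complex ^ 'm\<close> is the space
  \<open>\<ell>\<^sub>2\<^sup>m\<close> with \<open>m = CARD('m)\<close>.\<close>

instantiation vec :: (complex_normed_vector, finite) complex_normed_vector
begin

definition scaleC_vec :: "complex \<Rightarrow> 'a ^ 'b \<Rightarrow> 'a ^ 'b" where
  "a *\<^sub>C x = (\<chi> i. a *\<^sub>C (x $ i))"

instance
proof
  fix a b :: complex and r :: real and x y :: "'a ^ 'b"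
  show "a *\<^sub>C (x + y) = a *\<^sub>C x + a *\<^sub>C y"
    by (simp add: scaleC_vec_def vec_eq_iff scaleC_add_right)
  show "(a + b) *\<^sub>C x = a *\<^sub>C x + b *\<^sub>C x"
    by (simp add: scaleC_vec_def vec_eq_iff scaleC_add_left)
  show "a *\<^sub>C (b *\<^sub>C x) = (a * b) *\<^sub>C x"
    by (simp add: scaleC_vec_def vec_eq_iff scaleC_scaleC)
  show "1 *\<^sub>C x = x"
    by (simp add: scaleC_vec_def vec_eq_iff scaleC_one)
  show "complex_of_real r *\<^sub>C x = r *\<^sub>R x"
    by (simp add: scaleC_vec_def vec_eq_iff scaleC_of_real)
  show "norm (a *\<^sub>C x) = cmod a * norm x"
    by (simp add: scaleC_vec_def norm_vec_def norm_scaleC L2_set_right_distrib)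
qed

end

instance vec :: (complex_banach, finite) complex_banach ..


section \<open>The sequence space \<open>\<ell>\<^sub>2\<close>\<close>

lemma square_summable_add:
  fixes x y :: "nat \<Rightarrow> complex"
  assumes x: "summable (\<lambda>n. (cmod (x n))\<^sup>2)" and y: "summable (\<lambda>n. (cmod (y n))\<^sup>2)"
  shows "summable (\<lambda>n. (cmod (x n + y n))\<^sup>2)"
proof (rule summable_comparison_test)
  show "summable (\<lambda>n. 2 * (cmod (x n))\<^sup>2 + 2 * (cmod (y n))\<^sup>2)"
    by (intro summable_add summable_mult x y)
  have "(cmod (x n + y n))\<^sup>2 \<le> 2 * (cmod (x n))\<^sup>2 + 2 * (cmod (y n))\<^sup>2" for n
  proof -
    have "(cmod (x n + y n))\<^sup>2 \<le> (cmod (x n) + cmod (y n))\<^sup>2"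
      by (intro power_mono norm_triangle_ineq) simp
    also have "\<dots> \<le> 2 * (cmod (x n))\<^sup>2 + 2 * (cmod (y n))\<^sup>2"
      using zero_le_power2[of "cmod (x n) - cmod (y n)"]
      by (simp add: power2_sum power2_diff)
    finally show ?thesis .
  qed
  then show "\<exists>N. \<forall>n\<ge>N. norm ((cmod (x n + y n))\<^sup>2) \<le> 2 * (cmod (x n))\<^sup>2 + 2 * (cmod (y n))\<^sup>2"
    by auto
qed

lemma square_summable_mult:
  fixes x :: "nat \<Rightarrow> complex"
  assumes "summable (\<lambda>n. (cmod (x n))\<^sup>2)"
  shows "summable (\<lambda>n. (cmod (c * x n))\<^sup>2)"
  using summable_mult[OF assms, of "(cmod c)\<^sup>2"] by (simp add: norm_mult power_mult_distrib)

typedef ell2 = "{x :: nat \<Rightarrow> complex. summable (\<lambda>n. (cmod (x n))\<^sup>2)}"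
  morphisms ell2_nth Abs_ell2
  by (rule exI[of _ "\<lambda>_. 0"]) simp

lemma ell2_summable: "summable (\<lambda>n. (cmod (ell2_nth x n))\<^sup>2)"
  using ell2_nth[of x] by simp

lemma ell2_nth_Abs: "summable (\<lambda>n. (cmod (x n))\<^sup>2) \<Longrightarrow> ell2_nth (Abs_ell2 x) = x"
  by (simp add: Abs_ell2_inverse)

lemma ell2_eqI: "(\<And>n. ell2_nth x n = ell2_nth y n) \<Longrightarrow> x = y"
  using ell2_nth_inject by blast

instantiation ell2 :: complex_normed_vector
begin

definition zero_ell2 :: ell2 where "0 = Abs_ell2 (\<lambda>_. 0)"
definition plus_ell2 :: "ell2 \<Rightarrow> ell2 \<Rightarrow> ell2" where
  "x + y = Abs_ell2 (\<lambda>n. ell2_nth x n + ell2_nth y n)"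
definition scaleC_ell2 :: "complex \<Rightarrow> ell2 \<Rightarrow> ell2" where
  "a *\<^sub>C x = Abs_ell2 (\<lambda>n. a * ell2_nth x n)"
definition uminus_ell2 :: "ell2 \<Rightarrow> ell2" where
  "- x = Abs_ell2 (\<lambda>n. - ell2_nth x n)"
definition minus_ell2 :: "ell2 \<Rightarrow> ell2 \<Rightarrow> ell2" where
  "x - y = Abs_ell2 (\<lambda>n. ell2_nth x n - ell2_nth y n)"
definition scaleR_ell2 :: "real \<Rightarrow> ell2 \<Rightarrow> ell2" where
  "r *\<^sub>R x = Abs_ell2 (\<lambda>n. complex_of_real r * ell2_nth x n)"
definition norm_ell2 :: "ell2 \<Rightarrow> real" where
  "norm x = sqrt (\<Sum>n. (cmod (ell2_nth x n))\<^sup>2)"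
definition dist_ell2 :: "ell2 \<Rightarrow> ell2 \<Rightarrow> real" where
  "dist x y = norm (x - y)" for x y :: ell2
definition sgn_ell2 :: "ell2 \<Rightarrow> ell2" where
  "sgn x = inverse (norm x) *\<^sub>R x" for x :: ell2
definition uniformity_ell2 :: "(ell2 \<times> ell2) filter" where
  "uniformity_ell2 = (INF e\<in>{0 <..}. principal {(x, y). dist x y < e})"
definition open_ell2 :: "ell2 set \<Rightarrow> bool" where
  "open_ell2 U \<longleftrightarrow> (\<forall>x\<in>U. \<forall>\<^sub>F (x', y) in uniformity. x' = x \<longrightarrow> y \<in> U)"

lemma ell2_nth_zero: "ell2_nth 0 n = 0"
  by (simp add: zero_ell2_def ell2_nth_Abs)

lemma ell2_nth_add: "ell2_nth (x + y) n = ell2_nth x n + ell2_nth y n"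
  by (simp add: plus_ell2_def ell2_nth_Abs square_summable_add ell2_summable)

lemma ell2_nth_scaleC: "ell2_nth (a *\<^sub>C x) n = a * ell2_nth x n"
  by (simp only: scaleC_ell2_def ell2_nth_Abs square_summable_mult ell2_summable)

lemma ell2_nth_scaleR: "ell2_nth (r *\<^sub>R x) n = complex_of_real r * ell2_nth x n"
  by (simp only: scaleR_ell2_def ell2_nth_Abs square_summable_mult ell2_summable)

lemma ell2_nth_uminus: "ell2_nth (- x) n = - ell2_nth x n"
  by (simp add: uminus_ell2_def ell2_nth_Abs ell2_summable)

lemma ell2_nth_diff: "ell2_nth (x - y) n = ell2_nth x n - ell2_nth y n"
  using square_summable_add[OF ell2_summable[of x] ell2_summable[of "- y"]]
  by (simp add: minus_ell2_def ell2_nth_Abs ell2_nth_uminus)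

lemma L2_set_le_norm_ell2: "L2_set (\<lambda>n. cmod (ell2_nth x n)) {..<N} \<le> norm x"
  unfolding L2_set_def norm_ell2_def
  by (intro real_sqrt_le_mono sum_le_suminf ell2_summable) auto

lemma norm_ell2_leI:
  fixes x :: ell2
  assumes "\<And>N. L2_set (\<lambda>n. cmod (ell2_nth x n)) {..<N} \<le> e"
  shows "norm x \<le> e"
proof -
  have e: "0 \<le> e" using assms[of 0] by simp
  have "(\<Sum>n<N. (cmod (ell2_nth x n))\<^sup>2) \<le> e\<^sup>2" for N
    using assms[of N] by (simp add: L2_set_def real_sqrt_le_iff' sum_nonneg e sqrt_le_D)
  then have "(\<Sum>n. (cmod (ell2_nth x n))\<^sup>2) \<le> e\<^sup>2"
    by (intro suminf_le_const ell2_summable)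
  then show ?thesis
    unfolding norm_ell2_def using e by (simp add: real_le_lsqrt)
qed

lemma cmod_ell2_nth_le: "cmod (ell2_nth x n) \<le> norm x"
proof -
  have "cmod (ell2_nth x n) \<le> L2_set (\<lambda>n. cmod (ell2_nth x n)) {..<Suc n}"
    by (rule member_le_L2_set) auto
  also have "\<dots> \<le> norm x" by (rule L2_set_le_norm_ell2)
  finally show ?thesis .
qed

lemma norm_scaleC_ell2: "norm (a *\<^sub>C x) = cmod a * norm x" for x :: ell2
proof -
  have "(\<Sum>n. (cmod a)\<^sup>2 * (cmod (ell2_nth x n))\<^sup>2) = (cmod a)\<^sup>2 * (\<Sum>n. (cmod (ell2_nth x n))\<^sup>2)"
    by (rule suminf_mult) (rule ell2_summable)
  then show ?thesis
    by (simp add: norm_ell2_def ell2_nth_scaleC norm_mult power_mult_distrib real_sqrt_mult)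
qed

lemma scaleC_of_real_ell2: "complex_of_real r *\<^sub>C x = r *\<^sub>R x" for x :: ell2
  by (rule ell2_eqI) (simp add: ell2_nth_scaleC ell2_nth_scaleR)

lemma ell2_Cauchy_convergent:
  fixes X :: "nat \<Rightarrow> ell2"
  assumes C: "\<And>e. e > 0 \<Longrightarrow> \<exists>M. \<forall>m\<ge>M. \<forall>n\<ge>M. norm (X m - X n) < e"
  shows "\<exists>L. \<forall>e>0. \<exists>M. \<forall>m\<ge>M. norm (X m - L) \<le> e"
proof -
  have "Cauchy (\<lambda>k. ell2_nth (X k) n)" for n
  proof (rule CauchyI)
    fix e :: real assume "0 < e"
    then obtain M where "\<forall>m\<ge>M. \<forall>n\<ge>M. norm (X m - X n) < e" using C by blast
    then show "\<exists>M. \<forall>j\<ge>M. \<forall>k\<ge>M. norm (ell2_nth (X j) n - ell2_nth (X k) n) < e"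
      using cmod_ell2_nth_le by (metis ell2_nth_diff le_less_trans)
  qed
  then have "\<forall>n. \<exists>l. (\<lambda>k. ell2_nth (X k) n) \<longlonglongrightarrow> l"
    using Cauchy_convergent convergent_def by blast
  then obtain y where y: "\<And>n. (\<lambda>k. ell2_nth (X k) n) \<longlonglongrightarrow> y n" by metis
  have bound: "\<exists>M. \<forall>m\<ge>M. \<forall>N. L2_set (\<lambda>n. cmod (ell2_nth (X m) n - y n)) {..<N} \<le> e"
    if e: "0 < e" for e
  proof -
    obtain M where M: "\<forall>m\<ge>M. \<forall>n\<ge>M. norm (X m - X n) < e" using C[OF e] by blast
    have "L2_set (\<lambda>n. cmod (ell2_nth (X m) n - y n)) {..<N} \<le> e" if m: "m \<ge> M" for m N
    proof (rule LIMSEQ_le_const2)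
      show "(\<lambda>k. L2_set (\<lambda>n. cmod (ell2_nth (X m) n - ell2_nth (X k) n)) {..<N})
              \<longlonglongrightarrow> L2_set (\<lambda>n. cmod (ell2_nth (X m) n - y n)) {..<N}"
        unfolding L2_set_def by (intro tendsto_intros y)
      have "L2_set (\<lambda>n. cmod (ell2_nth (X m) n - ell2_nth (X k) n)) {..<N} \<le> e" if "k \<ge> M" for k
        using L2_set_le_norm_ell2[of "X m - X k" N] M m that
        by (fastforce simp: ell2_nth_diff)
      then show "\<exists>K. \<forall>k\<ge>K. L2_set (\<lambda>n. cmod (ell2_nth (X m) n - ell2_nth (X k) n)) {..<N} \<le> e"
        by blast
    qed
    then show ?thesis by blast
  qed
  obtain M where M: "\<And>N. L2_set (\<lambda>n. cmod (ell2_nth (X M) n - y n)) {..<N} \<le> 1"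
    using bound[of 1] by auto
  have "(\<Sum>n<N. (cmod (y n - ell2_nth (X M) n))\<^sup>2) \<le> 1" for N
    using M[of N] by (simp add: L2_set_def norm_minus_commute)
  then have "(\<Sum>n\<le>N. (cmod (y n - ell2_nth (X M) n))\<^sup>2) \<le> 1" for N
    by (metis lessThan_Suc_atMost)
  then have "summable (\<lambda>n. (cmod (y n - ell2_nth (X M) n))\<^sup>2)"
    by (intro bounded_imp_summable[where B = 1]) auto
  from square_summable_add[OF this ell2_summable[of "X M"]]
  have "ell2_nth (Abs_ell2 y) = y" by (simp add: ell2_nth_Abs)
  then have "\<forall>e>0. \<exists>M. \<forall>m\<ge>M. norm (X m - Abs_ell2 y) \<le> e"
    using bound by (metis (no_types, lifting) norm_ell2_leI ell2_nth_diff L2_set_cong)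
  then show ?thesis by blast
qed

instance
proof
  fix a b :: complex and r s :: real and x y z :: ell2 and U :: "ell2 set"
  show "x + y + z = x + (y + z)" "x + y = y + x" "0 + x = x" "- x + x = 0" "x - y = x + - y"
    "r *\<^sub>R (x + y) = r *\<^sub>R x + r *\<^sub>R y" "(r + s) *\<^sub>R x = r *\<^sub>R x + s *\<^sub>R x"
    "r *\<^sub>R s *\<^sub>R x = (r * s) *\<^sub>R x" "1 *\<^sub>R x = x"
    "a *\<^sub>C (x + y) = a *\<^sub>C x + a *\<^sub>C y" "(a + b) *\<^sub>C x = a *\<^sub>C x + b *\<^sub>C x"
    "a *\<^sub>C (b *\<^sub>C x) = (a * b) *\<^sub>C x" "1 *\<^sub>C x = x"
    by (rule ell2_eqI; simp add: ell2_nth_zero ell2_nth_add ell2_nth_scaleC ell2_nth_scaleR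
          ell2_nth_uminus ell2_nth_diff algebra_simps)+
  show "complex_of_real r *\<^sub>C x = r *\<^sub>R x" by (rule scaleC_of_real_ell2)
  show "dist x y = norm (x - y)" by (rule dist_ell2_def)
  show "sgn x = inverse (norm x) *\<^sub>R x" by (rule sgn_ell2_def)
  show "uniformity = (INF e\<in>{0 <..}. principal {(x, y :: ell2). dist x y < e})"
    by (rule uniformity_ell2_def)
  show "open U \<longleftrightarrow> (\<forall>x\<in>U. \<forall>\<^sub>F (x', y) in uniformity. x' = x \<longrightarrow> y \<in> U)"
    by (rule open_ell2_def)
  show "norm (a *\<^sub>C x) = cmod a * norm x" by (rule norm_scaleC_ell2)
  show "norm (r *\<^sub>R x) = \<bar>r\<bar> * norm x"
    using norm_scaleC_ell2[of "complex_of_real r" x] by (simp add: scaleC_of_real_ell2)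
  show "norm x = 0 \<longleftrightarrow> x = 0"
  proof
    assume "norm x = 0"
    then have "ell2_nth x n = 0" for n using cmod_ell2_nth_le[of x n] by simp
    then show "x = 0" by (intro ell2_eqI) (simp add: ell2_nth_zero)
  qed (simp add: norm_ell2_def ell2_nth_zero)
  show "norm (x + y) \<le> norm x + norm y"
  proof (rule norm_ell2_leI)
    fix N
    have "L2_set (\<lambda>n. cmod (ell2_nth (x + y) n)) {..<N}
        \<le> L2_set (\<lambda>n. cmod (ell2_nth x n) + cmod (ell2_nth y n)) {..<N}"
      by (rule L2_set_mono) (simp_all add: ell2_nth_add norm_triangle_ineq)
    also have "\<dots> \<le> L2_set (\<lambda>n. cmod (ell2_nth x n)) {..<N} + L2_set (\<lambda>n. cmod (ell2_nth y n)) {..<N}"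
      by (rule L2_set_triangle_ineq)
    also have "\<dots> \<le> norm x + norm y"
      by (intro add_mono L2_set_le_norm_ell2)
    finally show "L2_set (\<lambda>n. cmod (ell2_nth (x + y) n)) {..<N} \<le> norm x + norm y" .
  qed
qed

end

instance ell2 :: complex_banach
proof
  fix X :: "nat \<Rightarrow> ell2" assume X: "Cauchy X"
  have "\<exists>M. \<forall>m\<ge>M. \<forall>n\<ge>M. norm (X m - X n) < e" if "e > 0" for e
    using CauchyD[OF X that] .
  from ell2_Cauchy_convergent[OF this]
  obtain L where L: "\<And>e. e > 0 \<Longrightarrow> \<exists>M. \<forall>m\<ge>M. norm (X m - L) \<le> e" by blast
  have "X \<longlonglongrightarrow> L"
  proof (rule LIMSEQ_I)
    fix e :: real assume e: "0 < e"
    obtain M where "\<forall>m\<ge>M. norm (X m - L) \<le> e / 2" using L[of "e / 2"] e by auto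
    then show "\<exists>M. \<forall>m\<ge>M. norm (X m - L) < e"
      using e by (intro exI[of _ M]) fastforce
  qed
  then show "convergent X" by (rule convergentI)
qed


section \<open>Joint numerical index\<close>

definition bounded_clinear ::
    "('a::complex_normed_vector \<Rightarrow> 'b::complex_normed_vector) \<Rightarrow> bool" where
  "bounded_clinear T \<longleftrightarrow> bounded_linear T \<and> (\<forall>c x. T (c *\<^sub>C x) = c *\<^sub>C T x)"

text \<open>The dual consists of the bounded complex-linear functionals with the operator norm
  \<^const>\<open>onorm\<close>.\<close>

definition state_pairs :: "('a::complex_banach \<times> ('a \<Rightarrow> complex)) set" where
  "state_pairs = {(x, f). norm x = 1 \<and> bounded_clinear f \<and> onorm f = 1 \<and> f x = 1}"

text \<open>A tuple \<open>(T\<^sub>1, \<dots>, T\<^sub>k)\<close> is a family indexed by \<^typ>\<open>nat\<close> whose values outside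
  \<open>{1..k}\<close> are irrelevant. The suprema and the infimum are those of \<^typ>\<open>real\<close>; for tuples
  of bounded operators, \<open>p > 0\<close>, \<open>k \<ge> 1\<close> and a nonzero space, the sets are nonempty and
  bounded on the relevant side.\<close>

definition joint_norm ::
    "real \<Rightarrow> nat \<Rightarrow> (nat \<Rightarrow> 'a \<Rightarrow> 'a::complex_banach) \<Rightarrow> real" where
  "joint_norm p k T = (SUP x \<in> sphere 0 1. (\<Sum>i = 1..k. norm (T i x) powr p) powr (1 / p))"

definition joint_numerical_radius ::
    "real \<Rightarrow> nat \<Rightarrow> (nat \<Rightarrow> 'a \<Rightarrow> 'a::complex_banach) \<Rightarrow> real" where
  "joint_numerical_radius p k T =
     (SUP (x, f) \<in> state_pairs. (\<Sum>i = 1..k. cmod (f (T i x)) powr p) powr (1 / p))"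

definition joint_numerical_index :: "'a::complex_banach itself \<Rightarrow> real \<Rightarrow> nat \<Rightarrow> real" where
  "joint_numerical_index (X :: 'a itself) p k =
     Inf {joint_numerical_radius p k T | T :: nat \<Rightarrow> 'a \<Rightarrow> 'a.
            (\<forall>i \<in> {1..k}. bounded_clinear (T i)) \<and> joint_norm p k T = 1}"

end

theory Submission
  imports Defs
begin

text \<open>In a complex Hilbert space the states at a unit vector \<open>x\<close> reduce to \<open>\<langle>\<cdot>, x\<rangle>\<close>, and
  polarization gives \<open>\<parallel>T\<parallel> \<le> 2 w(T)\<close> for a single operator. Applied to each entry of a tuple this
  yields \<open>\<parallel>T\<parallel>\<^sub>p \<le> 2 k\<^bsup>1/p\<^esup> w\<^sub>p(T)\<close>. For \<open>p \<ge> 2\<close> and orthonormal \<open>e\<^sub>0, \<dots>, e\<^sub>k\<close> equality holds for the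
  rank-one operators \<open>T\<^sub>i x = \<langle>x, e\<^sub>0\<rangle> e\<^sub>i\<close>: with \<open>t\<^sub>i = \<bar>\<langle>x, e\<^sub>0\<rangle> \<langle>x, e\<^sub>i\<rangle>\<bar>\<close>, Bessel's inequality gives
  \<open>\<Sum> t\<^sub>i\<^sup>2 \<le> 1/4\<close>, hence \<open>\<Sum> t\<^sub>i\<^sup>p \<le> 2\<^bsup>-p\<^esup>\<close>. So the index is \<open>1 / (2 k\<^bsup>1/p\<^esup>)\<close> in all four cases.\<close>

section \<open>Inner product geometry common to \<open>complex ^ 'm\<close> and
  \<open>ell2\<close>\<close>

locale complex_inner_product =
  fixes ip :: "'a::complex_banach \<Rightarrow> 'a \<Rightarrow> complex"
  assumes ip_add_left: "ip (x + y) z = ip x z + ip y z"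
    and ip_scaleC_left: "ip (c *\<^sub>C x) y = c * ip x y"
    and ip_commute: "ip y x = cnj (ip x y)"
    and ip_self: "ip x x = complex_of_real ((norm x)\<^sup>2)"
begin

lemma ip_add_right: "ip x (y + z) = ip x y + ip x z"
  by (subst (1 2 3) ip_commute) (simp add: ip_add_left)

lemma ip_scaleC_right: "ip x (c *\<^sub>C y) = cnj c * ip x y"
  by (subst (1 2) ip_commute) (simp add: ip_scaleC_left)

lemmas ip_simps = ip_add_left ip_add_right ip_scaleC_left ip_scaleC_right

lemma ip_zero_left: "ip 0 y = 0"
  using ip_add_left[of 0 0 y] by simp

lemma ip_sum_left: "ip (sum f A) y = (\<Sum>a\<in>A. ip (f a) y)"
  by (induction A rule: infinite_finite_induct) (auto simp: ip_zero_left ip_add_left)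

lemma ip_sum_right: "ip y (sum f A) = (\<Sum>a\<in>A. ip y (f a))"
  by (subst (1 2) ip_commute) (simp add: ip_sum_left)

lemma norm_add_orthogonal:
  assumes "ip x y = 0"
  shows "(norm (x + y))\<^sup>2 = (norm x)\<^sup>2 + (norm y)\<^sup>2"
proof -
  have "ip y x = 0" using assms ip_commute[of y x] by simp
  then have "complex_of_real ((norm (x + y))\<^sup>2) = complex_of_real ((norm x)\<^sup>2 + (norm y)\<^sup>2)"
    using assms by (simp only: ip_self[symmetric] ip_simps of_real_add) simp
  then show ?thesis by (simp only: of_real_eq_iff)
qed

text \<open>Projection onto the line of the unit vector \<open>x\<close>. Both the Cauchy-Schwarz
  inequality and the description of states rest on this splitting.\<close>

lemma orthogonal_decomposition:
  assumes "norm x = 1"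
  obtains z where "y = ip y x *\<^sub>C x + z" "ip x z = 0"
proof
  show "y = ip y x *\<^sub>C x + (y + (- ip y x) *\<^sub>C x)"
    using scaleC_add_left[of "ip y x" "- ip y x" x] scaleC_of_real[of 0 x] by (simp add: algebra_simps)
  show "ip x (y + (- ip y x) *\<^sub>C x) = 0"
    using assms ip_commute[of x y] by (simp add: ip_simps ip_self)
qed

text \<open>Cauchy-Schwarz for a unit vector: Pythagoras for the decomposition, with the orthogonal
  remainder discarded.\<close>

lemma cmod_ip_le_unit:
  assumes "norm x = 1"
  shows "cmod (ip y x) \<le> norm y"
proof -
  obtain z where z: "y = ip y x *\<^sub>C x + z" "ip x z = 0"
    using orthogonal_decomposition[OF assms] .
  have "(norm y)\<^sup>2 = (norm (ip y x *\<^sub>C x))\<^sup>2 + (norm z)\<^sup>2"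
    by (subst (1) z(1), rule norm_add_orthogonal) (simp add: ip_simps z(2))
  then have "(cmod (ip y x))\<^sup>2 \<le> (norm y)\<^sup>2"
    using assms by (simp add: norm_scaleC)
  then show ?thesis by (rule power2_le_imp_le) simp
qed

lemma cmod_ip_le: "cmod (ip x y) \<le> norm x * norm y"
proof (cases "y = 0")
  case True
  then show ?thesis using ip_commute[of x 0] by (simp add: ip_zero_left)
next
  case False
  define u where "u = complex_of_real (1 / norm y) *\<^sub>C y"
  have u: "norm u = 1" using False by (simp add: u_def norm_scaleC norm_divide)
  have "cmod (ip x y) = cmod (ip x u) * norm y"
    using False by (simp add: u_def ip_simps norm_divide)
  also have "\<dots> \<le> norm x * norm y"
    by (intro mult_right_mono cmod_ip_le_unit u) simp
  finally show ?thesis .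
qed

section \<open>States at a unit vector\<close>

lemma state_pairs_ip:
  assumes x: "norm x = 1"
  shows "(x, \<lambda>y. ip y x) \<in> state_pairs"
proof -
  have scaleR: "ip (r *\<^sub>R y) x = r *\<^sub>R ip y x" for r y
    using ip_scaleC_left[of "complex_of_real r" y x]
    by (simp add: scaleC_of_real scaleR_conv_of_real)
  have bl: "bounded_linear (\<lambda>y. ip y x)"
    by (rule bounded_linear_intro[where K = 1]) (auto simp: ip_add_left scaleR cmod_ip_le_unit[OF x])
  have "onorm (\<lambda>y. ip y x) \<le> 1"
    by (rule onorm_bound) (auto simp: cmod_ip_le_unit[OF x])
  moreover have xx: "ip x x = 1" using x by (simp add: ip_self)
  moreover have "cmod (ip x x) \<le> onorm (\<lambda>y. ip y x) * norm x"
    by (rule onorm[OF bl])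
  ultimately have "onorm (\<lambda>y. ip y x) = 1" using x by simp
  then show ?thesis
    using x bl xx by (simp add: state_pairs_def bounded_clinear_def ip_scaleC_left scaleC_complex_def)
qed

text \<open>If \<open>f\<close> were nonzero at some \<open>z\<close> orthogonal to
  \<open>x\<close>, a suitable move from \<open>x\<close> along \<open>z\<close> would raise
  \<open>cmod (f _)\<close> by more than the norm, contradicting \<open>onorm f = 1\<close>.\<close>

lemma state_pairs_imp_eq_ip:
  assumes "(x, f) \<in> state_pairs"
  shows "f y = ip y x"
proof -
  have x: "norm x = 1" and bl: "bounded_linear f" and fC: "\<And>c v. f (c *\<^sub>C v) = c * f v"
    and f: "onorm f = 1" "f x = 1"
    using assms by (auto simp: state_pairs_def bounded_clinear_def scaleC_complex_def)
  note f_add = linear_add[OF bounded_linear.linear[OF bl]]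
  obtain z where z: "y = ip y x *\<^sub>C x + z" "ip x z = 0"
    using orthogonal_decomposition[OF x] .
  have f_le: "cmod (f v) \<le> norm v" for v
    using onorm[OF bl, of v] f by simp
  have "f z = 0"
  proof (rule ccontr)
    assume nz: "f z \<noteq> 0"
    then have z0: "norm z > 0" using f_le[of z] by (smt (verit) zero_less_norm_iff)
    \<comment> \<open>This \<open>s\<close> makes both \<open>s * f z\<close> and the squared norm
      of \<open>s *\<^sub>C z\<close> equal to \<open>q\<close>, which leads to the impossible
      \<open>(1 + q)^2 \<le> 1 + q\<close>.\<close>
    define s where "s = complex_of_real (1 / (norm z)\<^sup>2) * cnj (f z)"
    define q where "q = (cmod (f z) / norm z)\<^sup>2"
    have q: "q > 0" using nz z0 by (simp add: q_def)
    have "f (x + s *\<^sub>C z) = complex_of_real (1 + q)"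
      using complex_norm_square[of "f z"]
      by (simp add: f_add fC f s_def q_def power_divide mult.commute)
    moreover have "(norm (x + s *\<^sub>C z))\<^sup>2 = 1 + (cmod s * norm z)\<^sup>2"
      by (subst norm_add_orthogonal) (auto simp: ip_simps z x norm_scaleC)
    moreover have "(cmod s * norm z)\<^sup>2 = q"
      using z0 by (simp add: s_def q_def norm_mult norm_divide norm_power power2_eq_square)
    moreover have "(cmod (f (x + s *\<^sub>C z)))\<^sup>2 \<le> (norm (x + s *\<^sub>C z))\<^sup>2"
      by (intro power_mono f_le) simp
    ultimately have "(cmod (complex_of_real (1 + q)))\<^sup>2 \<le> 1 + q" by simp
    then have "(1 + q)\<^sup>2 \<le> 1 + q" using q by (simp only: norm_of_real power2_abs)
    then show False using q mult_pos_pos[OF q q] by (simp add: power2_eq_square algebra_simps)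
  qed
  then show ?thesis
    by (subst z(1)) (simp add: f_add fC f)
qed

section \<open>Norm and numerical radius of a single operator\<close>

lemma polarization:
  assumes T: "bounded_clinear T"
  shows "4 * ip (T x) y = (\<Sum>n<4. \<i> ^ n * ip (T (x + \<i> ^ n *\<^sub>C y)) (x + \<i> ^ n *\<^sub>C y))"
proof -
  have "T (u + v) = T u + T v" "T (c *\<^sub>C u) = c *\<^sub>C T u" for u v c
    using T linear_add[OF bounded_linear.linear] by (auto simp: bounded_clinear_def)
  \<comment> \<open>The sums of \<open>i^n\<close> and of \<open>i^(2n)\<close> over
    \<open>n < 4\<close> vanish, \<open>i\<close> being the imaginary unit, so after expansion only
    the terms in \<open>ip (T x) y\<close> survive.\<close>
  then show ?thesis
    by (simp add: ip_simps numeral_eq_Suc algebra_simps scaleC_one)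
qed

text \<open>The pairs \<open>n = 0, 2\<close> and \<open>n = 1, 3\<close> are two parallelogram
  laws. They control the four vectors occurring in \<open>polarization\<close>.\<close>

lemma parallelogram_four:
  fixes x y :: 'a
  shows "(\<Sum>n<4. (norm (x + \<i> ^ n *\<^sub>C y))\<^sup>2) = 4 * ((norm x)\<^sup>2 + (norm y)\<^sup>2)"
proof -
  have "(\<Sum>n<4. ip (x + \<i> ^ n *\<^sub>C y) (x + \<i> ^ n *\<^sub>C y)) = 4 * (ip x x + ip y y)"
    by (simp add: ip_simps numeral_eq_Suc algebra_simps scaleC_one)
  then have "complex_of_real (\<Sum>n<4. (norm (x + \<i> ^ n *\<^sub>C y))\<^sup>2)
      = complex_of_real (4 * ((norm x)\<^sup>2 + (norm y)\<^sup>2))"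
    by (simp only: ip_self of_real_sum of_real_mult of_real_add of_real_numeral)
  then show ?thesis by (simp only: of_real_eq_iff)
qed

text \<open>Pairing \<open>T x\<close> with its own direction \<open>y\<close> turns the norm into
  an inner product, which \<open>polarization\<close> expresses through the quadratic form. The four
  squared norms add up to 8, and division by 4 leaves the constant 2.\<close>

lemma norm_le_twice_numerical_radius:
  assumes T: "bounded_clinear T"
    and W: "\<And>x. norm x = 1 \<Longrightarrow> cmod (ip (T x) x) \<le> W"
    and x: "norm x = 1"
  shows "norm (T x) \<le> 2 * W"
proof (cases "T x = 0")
  case True
  \<comment> \<open>\<open>W\<close> is nonnegative because it bounds a modulus at
    \<open>x\<close>.\<close>
  then show ?thesis using order_trans[OF norm_ge_zero W[OF x]] by simp
next
  case False
  have TC: "T (c *\<^sub>C u) = c *\<^sub>C T u" for u c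
    using T by (auto simp: bounded_clinear_def)
  \<comment> \<open>The hypothesis on \<open>W\<close> concerns unit vectors, whereas those in
    \<open>polarization\<close> are not normalized; rescaling supplies the quadratic bound.\<close>
  have quad: "cmod (ip (T v) v) \<le> W * (norm v)\<^sup>2" for v
  proof (cases "v = 0")
    case True
    then show ?thesis using ip_commute[of "T 0" 0] by (simp add: ip_zero_left)
  next
    case False
    define c where "c = complex_of_real (1 / norm v)"
    have "norm (c *\<^sub>C v) = 1" using False by (simp add: c_def norm_scaleC norm_divide)
    from W[OF this] have "cmod c * (cmod c * cmod (ip (T v) v)) \<le> W"
      by (simp add: TC ip_simps norm_mult)
    then show ?thesis
      using False by (simp add: c_def norm_divide divide_simps power2_eq_square)
  qed
  define y where "y = complex_of_real (1 / norm (T x)) *\<^sub>C T x"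
  have y: "norm y = 1" using False by (simp add: y_def norm_scaleC norm_divide)
  have "ip (T x) y = complex_of_real (norm (T x))"
    using False by (simp add: y_def ip_simps ip_self power2_eq_square)
  then have "4 * norm (T x) = cmod (4 * ip (T x) y)"
    by (simp add: norm_mult)
  also have "\<dots> \<le> (\<Sum>n<4. cmod (\<i> ^ n * ip (T (x + \<i> ^ n *\<^sub>C y)) (x + \<i> ^ n *\<^sub>C y)))"
    unfolding polarization[OF T] by (rule norm_sum)
  also have "\<dots> \<le> (\<Sum>n<4. W * (norm (x + \<i> ^ n *\<^sub>C y))\<^sup>2)"
    by (intro sum_mono) (simp add: norm_mult norm_power quad)
  also have "\<dots> = W * (4 * ((norm x)\<^sup>2 + (norm y)\<^sup>2))"
    by (simp only: sum_distrib_left[symmetric] parallelogram_four)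
  finally show ?thesis using x y by simp
qed

text \<open>\<open>y\<close> is the orthogonal projection of \<open>x\<close> onto the span of the
  \<open>e i\<close>. Both \<open>ip x y\<close> and \<open>(norm y)^2\<close> equal the sum
  \<open>S\<close>, so Cauchy-Schwarz gives \<open>norm y \<le> norm x\<close>.\<close>

lemma bessel_inequality:
  assumes A: "finite A"
    and e: "\<And>i j. i \<in> A \<Longrightarrow> j \<in> A \<Longrightarrow> ip (e i) (e j) = (if i = j then 1 else 0)"
  shows "(\<Sum>i\<in>A. (cmod (ip x (e i)))\<^sup>2) \<le> (norm x)\<^sup>2"
proof -
  define y where "y = (\<Sum>i\<in>A. ip x (e i) *\<^sub>C e i)"
  define S where "S = (\<Sum>i\<in>A. (cmod (ip x (e i)))\<^sup>2)"
  have S0: "S \<ge> 0" by (simp add: S_def sum_nonneg)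
  have xy: "ip x y = complex_of_real S"
    unfolding y_def S_def ip_sum_right of_real_sum
    by (intro sum.cong) (simp_all only: ip_simps complex_norm_square mult.commute)
  have "ip y (e j) = ip x (e j)" if "j \<in> A" for j
  proof -
    have "ip y (e j) = (\<Sum>i\<in>A. if i = j then ip x (e i) else 0)"
      unfolding y_def ip_sum_left using that
      by (intro sum.cong) (auto simp: ip_simps e)
    then show ?thesis using that A by simp
  qed
  \<comment> \<open>Only the coefficients \<open>ip v (e i)\<close> enter here, and they agree for
    \<open>v = x\<close> and \<open>v = y\<close>.\<close>
  moreover have "ip v y = (\<Sum>i\<in>A. cnj (ip x (e i)) * ip v (e i))" for v
    by (simp add: y_def ip_sum_right ip_simps)
  ultimately have "ip y y = ip x y" by simp
  then have "complex_of_real ((norm y)\<^sup>2) = complex_of_real S"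
    using xy by (simp only: ip_self)
  then have yy: "(norm y)\<^sup>2 = S" by (simp only: of_real_eq_iff)
  have "S \<le> norm x * norm y"
    using cmod_ip_le[of x y] S0 by (simp add: xy)
  then have "norm y * norm y \<le> norm x * norm y" using yy by (simp add: power2_eq_square)
  then have "norm y \<le> norm x"
    by (cases "y = 0") auto
  then have "(norm y)\<^sup>2 \<le> (norm x)\<^sup>2" by (intro power_mono) auto
  then show ?thesis using yy by (simp add: S_def)
qed

section \<open>Lower bound for the joint numerical radius\<close>

lemma bdd_above_joint_numerical_radius:
  assumes T: "\<And>i. i \<in> {1..k} \<Longrightarrow> bounded_clinear (T i)" and p: "p > 0"
  shows "bdd_above ((\<lambda>(x, f). (\<Sum>i = 1..k. cmod (f (T i x)) powr p) powr (1 / p)) `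
           (state_pairs :: ('a \<times> ('a \<Rightarrow> complex)) set))"
proof (rule bdd_aboveI2)
  fix xf :: "'a \<times> ('a \<Rightarrow> complex)"
  assume xf: "xf \<in> state_pairs"
  obtain x f where [simp]: "xf = (x, f)" by (cases xf)
  have x: "norm x = 1" using xf by (auto simp: state_pairs_def)
  have "cmod (f (T i x)) \<le> onorm (T i)" if "i \<in> {1..k}" for i
  proof -
    have "cmod (f (T i x)) \<le> norm (T i x)"
      using xf state_pairs_imp_eq_ip cmod_ip_le_unit[OF x] by simp
    also have "\<dots> \<le> onorm (T i) * norm x"
      using T[OF that] by (intro onorm) (auto simp: bounded_clinear_def)
    finally show ?thesis using x by simp
  qed
  then show "(case xf of (x, f) \<Rightarrow> (\<Sum>i = 1..k. cmod (f (T i x)) powr p) powr (1 / p))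
      \<le> (\<Sum>i = 1..k. onorm (T i) powr p) powr (1 / p)"
    using p by (auto intro!: powr_mono2 sum_mono sum_nonneg)
qed

text \<open>The joint radius dominates the radius of every entry, so each entry has norm at most
  \<open>2 * w\<close>; adding \<open>k\<close> such \<open>p\<close>-th powers produces the factor
  \<open>real k powr (1 / p)\<close>. The vector \<open>u\<close> witnesses that the unit sphere is
  nonempty.\<close>

lemma joint_norm_le_joint_numerical_radius:
  fixes T :: "nat \<Rightarrow> 'a \<Rightarrow> 'a" and u :: 'a
  assumes T: "\<And>i. i \<in> {1..k} \<Longrightarrow> bounded_clinear (T i)" and p: "p > 0" and u: "norm u = 1"
  shows "joint_norm p k T \<le> 2 * real k powr (1 / p) * joint_numerical_radius p k T"
proof -
  define w where "w = joint_numerical_radius p k T"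
  have W: "cmod (ip (T i x) x) \<le> w" if x: "norm x = 1" and i: "i \<in> {1..k}" for x i
  proof -
    have "cmod (ip (T i x) x) = (cmod (ip (T i x) x) powr p) powr (1 / p)"
      using p by (simp add: powr_powr)
    also have "\<dots> \<le> (\<Sum>i = 1..k. cmod (ip (T i x) x) powr p) powr (1 / p)"
      using p i by (intro powr_mono2 member_le_sum) auto
    \<comment> \<open>A real \<open>SUP\<close> is known to dominate its members only for sets
      bounded above, hence the preceding lemma.\<close>
    also have "\<dots> \<le> w"
      unfolding w_def joint_numerical_radius_def
      using cSUP_upper[OF state_pairs_ip[OF x] bdd_above_joint_numerical_radius[where T = T and k = k, OF T p]]
      by simp
    finally show ?thesis .
  qed
  show ?thesis
    unfolding joint_norm_def w_def[symmetric]
  proof (rule cSUP_least)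
    show "sphere 0 1 \<noteq> ({} :: 'a set)" using u by auto
    fix x :: 'a assume "x \<in> sphere 0 1"
    then have x: "norm x = 1" by simp
    have le: "norm (T i x) \<le> 2 * w" if "i \<in> {1..k}" for i
      using norm_le_twice_numerical_radius[OF T[OF that] W[OF _ that] x] by simp
    show "(\<Sum>i = 1..k. norm (T i x) powr p) powr (1 / p) \<le> 2 * real k powr (1 / p) * w"
    \<comment> \<open>For \<open>k = 0\<close> both sides are 0. Otherwise the entry
      \<open>T 1\<close> forces \<open>w\<close> to be nonnegative, as cancelling the power
      \<open>p\<close> against the root requires.\<close>
    proof (cases "k = 0")
      case True
      then show ?thesis using p by simp
    next
      case False
      then have "norm (T 1 x) \<le> 2 * w" by (intro le) auto
      then have w0: "w \<ge> 0" using norm_ge_zero[of "T 1 x"] by linarith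
      have "(\<Sum>i = 1..k. norm (T i x) powr p) \<le> (\<Sum>i = 1..k. (2 * w) powr p)"
        using le p by (intro sum_mono powr_mono2) auto
      then have "(\<Sum>i = 1..k. norm (T i x) powr p) powr (1 / p)
          \<le> (real k * (2 * w) powr p) powr (1 / p)"
        using p by (intro powr_mono2) (auto intro: sum_nonneg)
      also have "\<dots> = real k powr (1 / p) * (2 * w)"
        using p w0 by (simp add: powr_mult powr_powr)
      finally show ?thesis by (simp add: algebra_simps)
    qed
  qed
qed

section \<open>The extremal rank-one tuple\<close>

lemma sum_powr_cross_terms_le:
  fixes e :: "nat \<Rightarrow> 'a"
  assumes e: "\<And>i j. i \<le> k \<Longrightarrow> j \<le> k \<Longrightarrow> ip (e i) (e j) = (if i = j then 1 else 0)"
    and x: "norm x = 1" and p: "p \<ge> 2"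
  shows "(\<Sum>i = 1..k. (cmod (ip x (e 0)) * cmod (ip x (e i))) powr p) \<le> (1 / 2) powr p"
proof -
  define b where "b = (\<lambda>i. cmod (ip x (e i)))"
  define t where "t = (\<lambda>i. b 0 * b i)"
  define S where "S = (\<Sum>i = 1..k. (b i)\<^sup>2)"
  have "(\<Sum>i\<in>{0..k}. (b i)\<^sup>2) \<le> (norm x)\<^sup>2"
    unfolding b_def by (rule bessel_inequality) (auto simp: e)
  then have b0S: "(b 0)\<^sup>2 + S \<le> 1"
    using x by (simp add: S_def sum.atLeast_Suc_atMost)
  \<comment> \<open>Arithmetic-geometric mean inequality for \<open>(b 0)^2\<close> and
    \<open>S\<close>, whose sum is at most 1 by Bessel; this is the origin of
    \<open>1 / 4\<close>.\<close>
  have "4 * ((b 0)\<^sup>2 * S) \<le> ((b 0)\<^sup>2 + S)\<^sup>2"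
    using zero_le_power2[of "(b 0)\<^sup>2 - S"] by (simp add: power2_sum power2_diff algebra_simps)
  also have "\<dots> \<le> 1\<^sup>2"
    using b0S by (intro power_mono) (auto simp: S_def intro!: add_nonneg_nonneg sum_nonneg)
  finally have "(b 0)\<^sup>2 * S \<le> 1 / 4" by simp
  then have t_sq: "(\<Sum>i = 1..k. (t i)\<^sup>2) \<le> 1 / 4"
    unfolding t_def S_def power_mult_distrib sum_distrib_left .
  have t_le: "t i \<le> 1 / 2" if "i \<in> {1..k}" for i
  proof -
    have "(t i)\<^sup>2 \<le> (\<Sum>i = 1..k. (t i)\<^sup>2)" using that by (intro member_le_sum) auto
    then have "(t i)\<^sup>2 \<le> (1 / 2)\<^sup>2" using t_sq by (simp add: power2_eq_square)
    then show ?thesis by (rule power2_le_imp_le) simp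
  qed
  have t0: "t i \<ge> 0" for i by (simp add: t_def b_def)
  \<comment> \<open>The excess exponent \<open>p - 2\<close> is nonnegative and is absorbed by
    \<open>t i \<le> 1 / 2\<close>, leaving squares to which \<open>t_sq\<close> applies.\<close>
  have t_powr: "t i powr p \<le> (t i)\<^sup>2 * (1 / 2) powr (p - 2)" if "i \<in> {1..k}" for i
  proof (cases "t i = 0")
    case False
    then have "t i powr p = (t i)\<^sup>2 * t i powr (p - 2)"
      using t0[of i] powr_add[of "t i" 2 "p - 2"] by (simp add: powr_numeral)
    also have "\<dots> \<le> (t i)\<^sup>2 * (1 / 2) powr (p - 2)"
      using p t_le[OF that] t0 by (intro mult_left_mono powr_mono2) auto
    finally show ?thesis .
  qed simp
  have "(\<Sum>i = 1..k. t i powr p) \<le> (\<Sum>i = 1..k. (t i)\<^sup>2 * (1 / 2) powr (p - 2))"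
    by (intro sum_mono t_powr)
  also have "\<dots> \<le> 1 / 4 * (1 / 2) powr (p - 2)"
    using t_sq by (simp only: sum_distrib_right[symmetric]) (intro mult_right_mono, auto)
  also have "\<dots> = (1 / 2) powr p"
    by (simp add: powr_diff powr_numeral power2_eq_square)
  finally show ?thesis by (simp add: t_def b_def)
qed

lemma bounded_clinear_rank_one: "bounded_clinear (\<lambda>x. (c * ip x u) *\<^sub>C v)"
proof -
  have "bounded_linear (\<lambda>x. (c * ip x u) *\<^sub>C v)"
  proof (rule bounded_linear_intro[where K = "cmod c * norm u * norm v"])
    fix x y r
    show "(c * ip (x + y) u) *\<^sub>C v = (c * ip x u) *\<^sub>C v + (c * ip y u) *\<^sub>C v"
      by (simp add: ip_simps algebra_simps scaleC_add_left)
    show "(c * ip (r *\<^sub>R x) u) *\<^sub>C v = r *\<^sub>R (c * ip x u) *\<^sub>C v"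
      by (simp add: scaleC_of_real[symmetric] ip_simps scaleC_scaleC algebra_simps)
    have "cmod c * (cmod (ip x u) * norm v) \<le> cmod c * ((norm x * norm u) * norm v)"
      by (intro mult_left_mono mult_right_mono cmod_ip_le) auto
    then show "norm ((c * ip x u) *\<^sub>C v) \<le> norm x * (cmod c * norm u * norm v)"
      by (simp add: norm_scaleC norm_mult algebra_simps)
  qed
  then show ?thesis
    by (simp add: bounded_clinear_def ip_simps scaleC_scaleC algebra_simps)
qed

text \<open>The \<open>k + 1\<close> orthonormal vectors are one input direction \<open>e 0\<close>
  and \<open>k\<close> output directions \<open>e 1, ..., e k\<close>. Hence the dimension must
  exceed \<open>k\<close>, and must be at least 3 for pairs.\<close>

theorem joint_numerical_index_eq:
  assumes e: "\<And>i j. i \<le> k \<Longrightarrow> j \<le> k \<Longrightarrow> ip (e i) (e j) = (if i = j then 1 else 0)"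
    and k: "k \<ge> 1" and p: "p \<ge> 2"
  shows "joint_numerical_index TYPE('a) p k = 1 / (2 * real k powr (1 / p))"
proof -
  have norm_e: "norm (e i) = 1" if "i \<le> k" for i
  proof -
    have "complex_of_real ((norm (e i))\<^sup>2) = complex_of_real 1"
      using e[OF that that] by (simp only: ip_self) simp
    then have "(norm (e i))\<^sup>2 = 1" by (simp only: of_real_eq_iff)
    then show ?thesis by (simp add: power2_eq_1_iff)
       (metis norm_ge_zero neg_0_le_iff_le not_one_le_zero)
  qed
  have e0: "norm (e 0) = 1" by (rule norm_e) simp
  define K where "K = real k powr (1 / p)"
  have K: "K > 0" using k by (simp add: K_def)
  have K_powr: "K powr p = real k" using p k by (simp add: K_def powr_powr)
  have lower: "1 / (2 * K) \<le> joint_numerical_radius p k T"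
    if "\<And>i. i \<in> {1..k} \<Longrightarrow> bounded_clinear (T i)" "joint_norm p k T = 1" for T :: "nat \<Rightarrow> 'a \<Rightarrow> 'a"
    using joint_norm_le_joint_numerical_radius[where T = T and k = k and p = p, OF that(1) _ e0] that(2) p K
    by (simp add: K_def[symmetric] divide_simps mult.commute)
  \<comment> \<open>The factor \<open>1 / K\<close> normalizes the tuple: at each \<open>x\<close>
    all \<open>k\<close> entries have the same norm, so passing to the \<open>p\<close>-norm
    multiplies it by exactly \<open>K\<close>.\<close>
  define T where "T = (\<lambda>i x. (complex_of_real (1 / K) * ip x (e 0)) *\<^sub>C e i)"
  have T: "bounded_clinear (T i)" for i
    unfolding T_def by (rule bounded_clinear_rank_one)
  have norm_T: "(\<Sum>i = 1..k. norm (T i x) powr p) powr (1 / p) = cmod (ip x (e 0))" for x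
  proof -
    have "(\<Sum>i = 1..k. norm (T i x) powr p) = (\<Sum>i = 1..k. (cmod (ip x (e 0)) / K) powr p)"
      using K norm_e by (intro sum.cong) (auto simp: T_def norm_scaleC norm_mult norm_divide)
    also have "\<dots> = cmod (ip x (e 0)) powr p"
      using k K by (simp add: powr_divide K_powr)
    finally show ?thesis using p by (simp add: powr_powr)
  qed
  have joint_norm_T: "joint_norm p k T = 1"
    unfolding joint_norm_def norm_T
  \<comment> \<open>The supremum is attained at \<open>e 0\<close>; Cauchy-Schwarz gives the upper
    bound.\<close>
  proof (rule cSup_eq_maximum)
    show "1 \<in> (\<lambda>x. cmod (ip x (e 0))) ` sphere 0 1"
      using e0 e[of 0 0] by (intro image_eqI[where x = "e 0"]) auto
    show "y \<le> 1" if "y \<in> (\<lambda>x. cmod (ip x (e 0))) ` sphere 0 1" for y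
    proof -
      obtain x where "norm x = 1" "y = cmod (ip x (e 0))" using \<open>y \<in> _\<close> by auto
      then show ?thesis using cmod_ip_le_unit[OF e0, of x] by simp
    qed
  qed
  have "joint_numerical_radius p k T \<le> 1 / (2 * K)"
    unfolding joint_numerical_radius_def
  proof (rule cSUP_least)
    show "state_pairs \<noteq> ({} :: ('a \<times> ('a \<Rightarrow> complex)) set)"
      using state_pairs_ip[OF e0] by auto
    fix xf :: "'a \<times> ('a \<Rightarrow> complex)" assume xf: "xf \<in> state_pairs"
    obtain x f where [simp]: "xf = (x, f)" by (cases xf)
    have x: "norm x = 1" using xf by (auto simp: state_pairs_def)
    have f: "f y = ip y x" for y using xf by (simp add: state_pairs_imp_eq_ip)
    \<comment> \<open>\<open>f (e i) = ip (e i) x\<close> is the conjugate of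
      \<open>ip x (e i)\<close>, so each value is a cross term divided by \<open>K\<close>.\<close>
    have "cmod (f (T i x)) = cmod (ip x (e 0)) * cmod (ip x (e i)) / K" for i
      using K ip_commute[of "e i" x] by (simp add: f T_def ip_simps norm_mult norm_divide)
    then have "(\<Sum>i = 1..k. cmod (f (T i x)) powr p)
        = (\<Sum>i = 1..k. (cmod (ip x (e 0)) * cmod (ip x (e i))) powr p) / K powr p"
      using K by (simp add: powr_divide sum_divide_distrib)
    also have "\<dots> \<le> (1 / 2) powr p / K powr p"
      using sum_powr_cross_terms_le[OF e x p] by (intro divide_right_mono) auto
    finally have "(\<Sum>i = 1..k. cmod (f (T i x)) powr p) powr (1 / p)
        \<le> ((1 / 2) powr p / K powr p) powr (1 / p)"
      using p by (intro powr_mono2) (auto intro: sum_nonneg)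
    also have "\<dots> = 1 / (2 * K)"
      using K p by (simp add: powr_divide[symmetric] powr_powr)
    finally show "(case xf of (x, f) \<Rightarrow> (\<Sum>i = 1..k. cmod (f (T i x)) powr p) powr (1 / p)) \<le> 1 / (2 * K)"
      by simp
  qed
  with lower[OF T joint_norm_T] have radius_T: "joint_numerical_radius p k T = 1 / (2 * K)" by simp
  show ?thesis
    unfolding joint_numerical_index_def K_def[symmetric]
  proof (rule cInf_eq_minimum)
    show "1 / (2 * K) \<in> {joint_numerical_radius p k T | T :: nat \<Rightarrow> 'a \<Rightarrow> 'a.
        (\<forall>i \<in> {1..k}. bounded_clinear (T i)) \<and> joint_norm p k T = 1}"
      using T joint_norm_T radius_T by (intro CollectI exI[of _ T]) auto
  qed (auto intro: lower)
qed

end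

section \<open>The space \<open>complex ^ 'm\<close>\<close>

definition vec_ip :: "complex ^ 'm \<Rightarrow> complex ^ 'm::finite \<Rightarrow> complex" where
  "vec_ip x y = (\<Sum>i\<in>UNIV. x $ i * cnj (y $ i))"

interpretation vec: complex_inner_product "vec_ip :: complex ^ 'm \<Rightarrow> complex ^ 'm::finite \<Rightarrow> complex"
proof
  fix x y z :: "complex ^ 'm" and c :: complex
  show "vec_ip (x + y) z = vec_ip x z + vec_ip y z"
    by (simp add: vec_ip_def algebra_simps sum.distrib)
  show "vec_ip (c *\<^sub>C x) y = c * vec_ip x y"
    by (simp add: vec_ip_def scaleC_vec_def scaleC_complex_def sum_distrib_left mult.assoc)
  show "vec_ip y x = cnj (vec_ip x y)"
    by (simp add: vec_ip_def mult.commute)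
  show "vec_ip x x = complex_of_real ((norm x)\<^sup>2)"
    unfolding vec_ip_def complex_norm_square[symmetric] of_real_sum[symmetric]
    by (simp add: norm_vec_def L2_set_def sum_nonneg)
qed

lemma joint_numerical_index_vec:
  assumes "1 \<le> k" "k < CARD('m::finite)" "2 \<le> p"
  shows "joint_numerical_index TYPE(complex ^ 'm) p k = 1 / (2 * real k powr (1 / p))"
proof -
  \<comment> \<open>\<open>{..k}\<close> has \<open>k + 1\<close> elements, so
    \<open>k < CARD('m)\<close> is just what an injective choice of \<open>k + 1\<close> coordinates
    requires.\<close>
  have "card {..k} \<le> CARD('m)" using assms(2) by simp
  then obtain g :: "nat \<Rightarrow> 'm" where g: "inj_on g {..k}"
    using card_le_inj[of "{..k}" "UNIV :: 'm set"] by auto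
  show ?thesis
  proof (rule vec.joint_numerical_index_eq[where e = "\<lambda>i. axis (g i) 1"])
    fix i j assume "i \<le> k" "j \<le> k"
    then have "g j = g i \<longleftrightarrow> i = j" using g by (auto simp: inj_on_eq_iff)
    then show "vec_ip (axis (g i) 1) (axis (g j) 1) = (if i = j then 1 else 0)"
      by (simp add: vec_ip_def axis_def if_distrib[of "\<lambda>t. _ * t"] if_distrib[of cnj] cong: if_cong)
  qed (use assms in auto)
qed

section \<open>The space \<open>ell2\<close>\<close>

definition ell2_ip :: "ell2 \<Rightarrow> ell2 \<Rightarrow> complex" where
  "ell2_ip x y = (\<Sum>n. ell2_nth x n * cnj (ell2_nth y n))"

text \<open>Comparison via \<open>a * b \<le> a^2 + b^2\<close> for nonnegative \<open>a\<close>,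
  \<open>b\<close>. Linearity of \<open>suminf\<close> in the interpretation below rests on this
  convergence.\<close>

lemma summable_ell2_ip: "summable (\<lambda>n. ell2_nth x n * cnj (ell2_nth y n))"
proof (rule summable_comparison_test)
  show "summable (\<lambda>n. (cmod (ell2_nth x n))\<^sup>2 + (cmod (ell2_nth y n))\<^sup>2)"
    by (intro summable_add ell2_summable)
  have "norm (ell2_nth x n * cnj (ell2_nth y n)) \<le> (cmod (ell2_nth x n))\<^sup>2 + (cmod (ell2_nth y n))\<^sup>2" for n
  proof -
    have "0 \<le> cmod (ell2_nth x n) * cmod (ell2_nth y n)" by simp
    then show ?thesis
      using sum_squares_bound[of "cmod (ell2_nth x n)" "cmod (ell2_nth y n)"]
      unfolding norm_mult complex_mod_cnj by linarith
  qed
  then show "\<exists>N. \<forall>n\<ge>N. norm (ell2_nth x n * cnj (ell2_nth y n))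
      \<le> (cmod (ell2_nth x n))\<^sup>2 + (cmod (ell2_nth y n))\<^sup>2"
    by blast
qed

interpretation ell2: complex_inner_product ell2_ip
proof
  fix x y z :: ell2 and c :: complex
  show "ell2_ip (x + y) z = ell2_ip x z + ell2_ip y z"
    using suminf_add[OF summable_ell2_ip[of x z] summable_ell2_ip[of y z]]
    by (simp add: ell2_ip_def ell2_nth_add algebra_simps)
  show "ell2_ip (c *\<^sub>C x) y = c * ell2_ip x y"
    using suminf_mult[OF summable_ell2_ip[of x y], of c]
    by (simp add: ell2_ip_def ell2_nth_scaleC mult.assoc)
  show "ell2_ip y x = cnj (ell2_ip x y)"
    using bounded_linear.suminf[OF bounded_linear_cnj summable_ell2_ip[of x y]]
    by (simp add: ell2_ip_def mult.commute)
  show "ell2_ip x x = complex_of_real ((norm x)\<^sup>2)"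
    unfolding ell2_ip_def complex_norm_square[symmetric]
    by (simp only: suminf_of_real[OF ell2_summable, symmetric])
      (simp add: norm_ell2_def suminf_nonneg ell2_summable)
qed

lemma joint_numerical_index_ell2:
  assumes "1 \<le> k" "2 \<le> p"
  shows "joint_numerical_index TYPE(ell2) p k = 1 / (2 * real k powr (1 / p))"
proof -
  \<comment> \<open>The unit sequences; their finite support gives the square-summability that
    \<open>ell2_nth_Abs\<close> asks for.\<close>
  define d :: "nat \<Rightarrow> nat \<Rightarrow> complex" where "d = (\<lambda>i n. if n = i then 1 else 0)"
  have "summable (\<lambda>n. (cmod (d i n))\<^sup>2)" for i
    by (rule summable_finite[of "{i}"]) (auto simp: d_def)
  then have nth: "ell2_nth (Abs_ell2 (d i)) = d i" for i
    by (rule ell2_nth_Abs)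
  have "ell2_ip (Abs_ell2 (d i)) (Abs_ell2 (d j)) = (if i = j then 1 else 0)" for i j
    unfolding ell2_ip_def nth by (subst suminf_finite[of "{i}"]) (auto simp: d_def)
  then show ?thesis
    using ell2.joint_numerical_index_eq[where e = "\<lambda>i. Abs_ell2 (d i)"] assms by blast
qed

theorem theorem3p10:
  assumes "CARD('m::finite) \<ge> 3"
  shows "(\<forall>k::nat. 1 \<le> k \<and> k < CARD('m) \<longrightarrow>
            joint_numerical_index TYPE(complex ^ 'm) 2 k = 1 / (2 * sqrt (real k)))
       \<and> (\<forall>k::nat. 1 \<le> k \<longrightarrow>
            joint_numerical_index TYPE(ell2) 2 k = 1 / (2 * sqrt (real k)))
       \<and> (\<forall>p::real. 2 < p \<longrightarrow>
            joint_numerical_index TYPE(complex ^ 'm) p 2 = 1 / 2 powr (1 + 1 / p))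
       \<and> (\<forall>p::real. 2 < p \<longrightarrow>
            joint_numerical_index TYPE(ell2) p 2 = 1 / 2 powr (1 + 1 / p))"
  \<comment> \<open>At \<open>p = 2\<close> the factor \<open>real k powr (1 / p)\<close> is a
    square root; at \<open>k = 2\<close> the denominator is \<open>2 * 2 powr (1 / p)\<close>, and
    \<open>CARD('m) \<ge> 3\<close> yields \<open>2 < CARD('m)\<close>.\<close>
  using assms
  by (simp add: joint_numerical_index_vec joint_numerical_index_ell2 powr_half_sqrt powr_add)

end
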